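(* Let $m\ge1$, $n_1,\dots,n_m$ positive integers, and $k_1<\dots<k_{m-1}\le k_m$ positive integers with $k_1\le n_1$ and $k_i<k_{i-1}+n_i$ for $1<i\le m$. Let $G=H_\forall(\mathbf n,\mathbf k)$. Then $G$ is a weighted majority game if and only if one of the following holds: (1) $m=1$; (2) $m=2$ and $k_2=k_1+1$; (3) $m=2$ and $n_2=k_2-k_1+1$; (4) $k_1=n_1$ and either $m=2$, or $m=3$ and the reduced game $H_\forall((n_2,n_3),(k_2-k_1,k_3-k_1))$ falls under (2) or (3), i.e. $k_3=k_2+1$ or $n_3=k_3-k_2+1$; (5) $m\in\{2,3,4\}$, $k_m=k_{m-1}$, and the parameters $\mathbf n'=(n_1,\dots,n_{m-1})$, $\mathbf k'=(k_1,\dots,k_{m-1})$ of the $(m-1)$-level game $H_\forall(\mathbf n',\mathbf k')$ satisfy one of (1)–(4) (with $m-1$ in place of $m$).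
   Context: Submultisets of $\{1^{n_1},\dots,m^{n_m}\}$ are written $\{1^{\ell_1},\dots,m^{\ell_m}\}$ with $0\le\ell_i\le n_i$. The conjunctive hierarchical game $H_\forall(\mathbf n,\mathbf k)$, $\mathbf n=(n_1,\dots,n_m)$, $\mathbf k=(k_1,\dots,k_m)$, is the simple game on the multiset $\{1^{n_1},\dots,m^{n_m}\}$ in which $\{1^{\ell_1},\dots,m^{\ell_m}\}$ is winning iff $\ell_1+\dots+\ell_i\ge k_i$ for all $i$. A game on this multiset is a weighted majority game if there exist nonnegative weights $w_1,\dots,w_m$ and $q\ge0$ such that $\{1^{\ell_1},\dots,m^{\ell_m}\}$ is winning iff $\sum_i\ell_iw_i\ge q$. *)

theory Defs
  imports Complex_Main "HOL-Library.Multiset"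
begin

text \<open>
  The multiset \<open>{1^{n 1}, ..., m^{n m}}\<close>. Vectors such as \<open>(n 1, ..., n m)\<close> are functions on
  \<open>nat\<close> of which only the values on \<open>{1..m}\<close> are used.
\<close>

definition level_mset :: "nat \<Rightarrow> (nat \<Rightarrow> nat) \<Rightarrow> nat multiset" where
  "level_mset m n = (\<Sum>i\<in>{1..m}. replicate_mset (n i) i)"

text \<open>
  A game on a multiset is given by its set of winning submultisets.
\<close>

definition simple_game :: "'a multiset \<Rightarrow> 'a multiset set \<Rightarrow> bool" where
  "simple_game M W \<longleftrightarrow>
     (\<forall>X\<in>W. X \<subseteq># M) \<and> (\<forall>X Y. X \<in> W \<and> X \<subseteq># Y \<and> Y \<subseteq># M \<longrightarrow> Y \<in> W)"

definition weighted_majority_game :: "nat \<Rightarrow> (nat \<Rightarrow> nat) \<Rightarrow> nat multiset set \<Rightarrow> bool" where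
  "weighted_majority_game m n W \<longleftrightarrow>
     (\<exists>(w :: nat \<Rightarrow> real) (q :: real). (\<forall>i\<in>{1..m}. 0 \<le> w i) \<and> 0 \<le> q \<and>
        (\<forall>X. X \<subseteq># level_mset m n \<longrightarrow>
           (X \<in> W \<longleftrightarrow> q \<le> (\<Sum>i=1..m. real (count X i) * w i))))"

definition H_forall :: "nat \<Rightarrow> (nat \<Rightarrow> nat) \<Rightarrow> (nat \<Rightarrow> nat) \<Rightarrow> nat multiset set" where
  "H_forall m n k =
     {X. X \<subseteq># level_mset m n \<and> (\<forall>i\<in>{1..m}. k i \<le> (\<Sum>j=1..i. count X j))}"

lemma count_level_mset: "count (level_mset m n) i = (if i \<in> {1..m} then n i else 0)"
  by (simp add: level_mset_def count_sum sum.delta')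

lemma simple_game_H_forall: "simple_game (level_mset m n) (H_forall m n k)"
  unfolding simple_game_def H_forall_def
  by (auto intro: order_trans[OF _ sum_mono] dest: mset_subset_eq_count)

text \<open>
  The conditions below are only used for parameters with \<open>k 1 \<le> ... \<le> k m\<close>, so the natural-number
  subtractions do not truncate.
\<close>

definition wm_case1 :: "nat \<Rightarrow> (nat \<Rightarrow> nat) \<Rightarrow> (nat \<Rightarrow> nat) \<Rightarrow> bool" where
  "wm_case1 m n k \<longleftrightarrow> m = 1"

definition wm_case2 :: "nat \<Rightarrow> (nat \<Rightarrow> nat) \<Rightarrow> (nat \<Rightarrow> nat) \<Rightarrow> bool" where
  "wm_case2 m n k \<longleftrightarrow> m = 2 \<and> k 2 = k 1 + 1"

definition wm_case3 :: "nat \<Rightarrow> (nat \<Rightarrow> nat) \<Rightarrow> (nat \<Rightarrow> nat) \<Rightarrow> bool" where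
  "wm_case3 m n k \<longleftrightarrow> m = 2 \<and> n 2 = k 2 - k 1 + 1"

text \<open>
  For \<open>m = 3\<close> the shifted functions are the vectors \<open>(n 2, n 3)\<close> and \<open>(k 2 - k 1, k 3 - k 1)\<close>.
\<close>

definition wm_case4 :: "nat \<Rightarrow> (nat \<Rightarrow> nat) \<Rightarrow> (nat \<Rightarrow> nat) \<Rightarrow> bool" where
  "wm_case4 m n k \<longleftrightarrow> k 1 = n 1 \<and>
     (m = 2 \<or>
      m = 3 \<and> (wm_case2 2 (\<lambda>i. n (i + 1)) (\<lambda>i. k (i + 1) - k 1) \<or>
               wm_case3 2 (\<lambda>i. n (i + 1)) (\<lambda>i. k (i + 1) - k 1)))"

text \<open>
  Dropping the last level leaves \<open>n\<close> and \<open>k\<close> unchanged as functions; only \<open>m\<close> becomes \<open>m - 1\<close>.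
\<close>

definition wm_case5 :: "nat \<Rightarrow> (nat \<Rightarrow> nat) \<Rightarrow> (nat \<Rightarrow> nat) \<Rightarrow> bool" where
  "wm_case5 m n k \<longleftrightarrow> m \<in> {2, 3, 4} \<and> k m = k (m - 1) \<and>
     (wm_case1 (m - 1) n k \<or> wm_case2 (m - 1) n k \<or>
      wm_case3 (m - 1) n k \<or> wm_case4 (m - 1) n k)"

end

theory Submission
  imports Defs
begin

text \<open>
  Let \<open>d i = k i - k (i - 1)\<close>. The coalition \<open>d\<close> meets every threshold exactly. If \<open>0 < d a < n a\<close>
  and two units can be both added to and removed from \<open>d\<close> at levels after \<open>a\<close>, then trading one
  unit of level \<open>a\<close> against these two units splits \<open>d + d\<close> into two losing coalitions: one violates
  the threshold at \<open>a\<close>, the other a later one. No weights can exist then. The two units are taken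
  from levels \<open>a + 1\<close> and \<open>a + 2\<close>, or both from level \<open>a + 1\<close>, with \<open>a = 1\<close>, or \<open>a = 2\<close> if
  \<open>k 1 = n 1\<close>; this works in all cases but the listed ones, for which weights are explicit.
\<close>

section \<open>Coalitions as count vectors\<close>

lemma subset_level_mset_iff:
  "X \<subseteq># level_mset m n \<longleftrightarrow> (\<forall>i. count X i \<le> (if i \<in> {1..m} then n i else 0))"
  by (simp add: subseteq_mset_def count_level_mset)

text \<open>A submultiset is determined by its counts, so coalitions can be handled as functions
  \<open>l\<close> bounded by \<open>n\<close> on \<open>{1..m}\<close>; other values of
  \<open>l\<close> enter neither side of the equivalence.\<close>

lemma weighted_H_forall_iff:
  "weighted_majority_game m n (H_forall m n k) \<longleftrightarrow>
     (\<exists>(w :: nat \<Rightarrow> real) q. (\<forall>i\<in>{1..m}. 0 \<le> w i) \<and> 0 \<le> q \<and>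
        (\<forall>l. (\<forall>i\<in>{1..m}. l i \<le> n i) \<longrightarrow>
           ((\<forall>i\<in>{1..m}. k i \<le> (\<Sum>j=1..i. l j)) \<longleftrightarrow> q \<le> (\<Sum>i=1..m. real (l i) * w i))))"
proof -
  have "(\<forall>X. X \<subseteq># level_mset m n \<longrightarrow>
           (X \<in> H_forall m n k \<longleftrightarrow> q \<le> (\<Sum>i=1..m. real (count X i) * w i))) \<longleftrightarrow>
        (\<forall>l. (\<forall>i\<in>{1..m}. l i \<le> n i) \<longrightarrow>
           ((\<forall>i\<in>{1..m}. k i \<le> (\<Sum>j=1..i. l j)) \<longleftrightarrow> q \<le> (\<Sum>i=1..m. real (l i) * w i)))"
    (is "?L \<longleftrightarrow> ?R") for w :: "nat \<Rightarrow> real" and q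
  proof
    assume L: ?L
    show ?R
    proof (intro allI impI)
      fix l assume l: "\<forall>i\<in>{1..m}. l i \<le> n i"
      \<comment> \<open>\<open>level_mset\<close> with \<open>l\<close> in place of \<open>n\<close>
        realizes the count vector \<open>l\<close> as a submultiset.\<close>
      let ?X = "level_mset m l"
      have sub: "?X \<subseteq># level_mset m n"
        using l by (simp add: subset_level_mset_iff count_level_mset)
      have 1: "(\<Sum>j=1..i. count ?X j) = (\<Sum>j=1..i. l j)" if "i \<in> {1..m}" for i
        using that by (intro sum.cong) (auto simp: count_level_mset)
      have wins_iff: "(\<forall>i\<in>{1..m}. k i \<le> (\<Sum>j=1..i. count ?X j)) \<longleftrightarrow>
          (\<forall>i\<in>{1..m}. k i \<le> (\<Sum>j=1..i. l j))"
        by (intro ball_cong refl) (simp only: 1)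
      have 2: "(\<Sum>i=1..m. real (count ?X i) * w i) = (\<Sum>i=1..m. real (l i) * w i)"
        by (intro sum.cong) (auto simp: count_level_mset)
      show "(\<forall>i\<in>{1..m}. k i \<le> (\<Sum>j=1..i. l j)) \<longleftrightarrow> q \<le> (\<Sum>i=1..m. real (l i) * w i)"
        using L[rule_format, OF sub] sub 2 wins_iff unfolding H_forall_def by auto
    qed
  next
    assume R: ?R
    show ?L
    proof (intro allI impI)
      fix X assume sub: "X \<subseteq># level_mset m n"
      then have "\<forall>i\<in>{1..m}. count X i \<le> n i"
        by (auto simp: subset_level_mset_iff dest!: spec split: if_splits)
      then show "X \<in> H_forall m n k \<longleftrightarrow> q \<le> (\<Sum>i=1..m. real (count X i) * w i)"
        using R sub by (auto simp: H_forall_def)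
    qed
  qed
  then show ?thesis
    unfolding weighted_majority_game_def by simp
qed

section \<open>A trading argument against weights\<close>

text \<open>The sum telescopes; monotonicity keeps the subtractions from truncating. Level 1 is
  separate because \<open>k 0\<close> is unconstrained.\<close>

lemma sum_step_differences:
  fixes k :: "nat \<Rightarrow> nat"
  assumes "\<And>i. 1 < i \<Longrightarrow> i \<le> m \<Longrightarrow> k (i - 1) \<le> k i" and "1 \<le> i" "i \<le> m"
  shows "(\<Sum>j=1..i. if j = 1 then k 1 else k j - k (j - 1)) = k i"
  using assms(2,3)
proof (induction i rule: nat_induct_at_least)
  case base
  then show ?case by simp
next
  case (Suc i)
  then show ?case using assms(1)[of "Suc i"] by simp
qed

text \<open>Here \<open>e\<close> holds the units traded against one unit of level \<open>a\<close>,
  and \<open>b\<close> is a level up to which at least two of them occur. Adding \<open>e\<close>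
  and giving up the unit falls one short at \<open>a\<close>, the reverse trade falls short at
  \<open>b\<close>, yet the two weights add up to twice that of the winning
  \<open>d\<close>.\<close>

lemma not_weighted_trade:
  fixes d e :: "nat \<Rightarrow> nat"
  assumes sum_d: "\<And>i. i \<in> {1..m} \<Longrightarrow> (\<Sum>j=1..i. d j) = k i"
    and d_le: "\<And>i. i \<in> {1..m} \<Longrightarrow> d i \<le> n i"
    and a: "1 \<le> a" "0 < d a" "d a < n a"
    and b: "a \<le> b" "b \<le> m" "2 \<le> (\<Sum>i=1..b. e i)"
    and e0: "\<And>i. i \<le> a \<Longrightarrow> e i = 0"
    and e: "\<And>i. i \<in> {1..m} \<Longrightarrow> e i \<le> d i \<and> d i + e i \<le> n i"
  shows "\<not> weighted_majority_game m n (H_forall m n k)"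
proof
  assume "weighted_majority_game m n (H_forall m n k)"
  then obtain w :: "nat \<Rightarrow> real" and q where
    wq: "\<And>l. \<forall>i\<in>{1..m}. l i \<le> n i \<Longrightarrow>
      ((\<forall>i\<in>{1..m}. k i \<le> (\<Sum>j=1..i. l j)) \<longleftrightarrow> q \<le> (\<Sum>i=1..m. real (l i) * w i))"
    unfolding weighted_H_forall_iff by blast
  define u where "u i = (if i = a then 1 else 0 :: nat)" for i
  define C where "C i = d i + e i - u i" for i
  define D where "D i = d i + u i - e i" for i
  \<comment> \<open>The additive forms record that no subtraction truncates: for \<open>C\<close>
    because \<open>0 < d a\<close>, for \<open>D\<close> because
    \<open>e i \<le> d i\<close>.\<close>
  have C: "C i + u i = d i + e i" for i
    using a by (auto simp: C_def u_def)
  have D: "D i + e i = d i + u i" if "i \<in> {1..m}" for i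
    using e[OF that] by (auto simp: D_def)
  have sum_u: "(\<Sum>i=1..j. u i) = 1" if "a \<le> j" for j
    using a that by (simp add: u_def)
  have "(\<Sum>i=1..a. C i) + (\<Sum>i=1..a. u i) = (\<Sum>i=1..a. d i) + (\<Sum>i=1..a. e i)"
    by (simp add: C flip: sum.distrib)
  moreover have "(\<Sum>i=1..a. e i) = 0"
    using e0 by simp
  ultimately have "(\<Sum>i=1..a. C i) < k a"
    using sum_u[of a] sum_d[of a] a b by simp
  then have C_loses: "\<not> (\<forall>i\<in>{1..m}. k i \<le> (\<Sum>j=1..i. C j))"
    using a b by (auto simp: not_le intro!: bexI[of _ a])
  have "(\<Sum>i=1..b. D i) + (\<Sum>i=1..b. e i) = (\<Sum>i=1..b. d i) + (\<Sum>i=1..b. u i)"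
    unfolding sum.distrib[symmetric] using b D by (intro sum.cong) auto
  then have "(\<Sum>i=1..b. D i) < k b"
    using sum_u[of b] sum_d[of b] a b by simp
  then have D_loses: "\<not> (\<forall>i\<in>{1..m}. k i \<le> (\<Sum>j=1..i. D j))"
    using a b by (auto simp: not_le intro!: bexI[of _ b])
  have C_le: "\<forall>i\<in>{1..m}. C i \<le> n i"
    using e by (auto simp: C_def intro: diff_le_self order_trans)
  have D_le: "\<forall>i\<in>{1..m}. D i \<le> n i"
  proof
    fix i assume "i \<in> {1..m}"
    then have "d i \<le> n i" by (rule d_le)
    then show "D i \<le> n i" using a by (cases "i = a") (auto simp: D_def u_def)
  qed
  have "(\<Sum>i=1..m. real (C i) * w i) < q"
    using wq[OF C_le] C_loses by simp
  moreover have "(\<Sum>i=1..m. real (D i) * w i) < q"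
    using wq[OF D_le] D_loses by simp
  moreover have "q \<le> (\<Sum>i=1..m. real (d i) * w i)"
    using wq[of d] d_le sum_d by simp
  moreover have "(\<Sum>i=1..m. real (C i) * w i) + (\<Sum>i=1..m. real (D i) * w i) =
      2 * (\<Sum>i=1..m. real (d i) * w i)"
  proof -
    have "real (C i) * w i + real (D i) * w i = 2 * (real (d i) * w i)" if "i \<in> {1..m}" for i
    proof -
      have "C i + D i = 2 * d i"
        using C[of i] D[OF that] by simp
      then have "real (C i) + real (D i) = 2 * real (d i)"
        by (metis of_nat_add of_nat_mult of_nat_numeral)
      then show ?thesis
        by (metis distrib_right mult.assoc)
    qed
    then show ?thesis
      by (simp add: sum_distrib_left flip: sum.distrib)
  qed
  ultimately show False by simp
qed

section \<open>Adding a level at either end\<close>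

text \<open>Partial sums never decrease, so meeting \<open>k m\<close> at level \<open>m\<close>
  already meets the equal threshold at \<open>Suc m\<close>; the new level gets weight 0.\<close>

lemma weighted_append_trivial_level:
  assumes "weighted_majority_game m n (H_forall m n k)" and "1 \<le> m" and "k (Suc m) = k m"
  shows "weighted_majority_game (Suc m) n (H_forall (Suc m) n k)"
proof -
  obtain w :: "nat \<Rightarrow> real" and q where w: "\<forall>i\<in>{1..m}. 0 \<le> w i" and q: "0 \<le> q" and
    wq: "\<And>l. \<forall>i\<in>{1..m}. l i \<le> n i \<Longrightarrow>
      ((\<forall>i\<in>{1..m}. k i \<le> (\<Sum>j=1..i. l j)) \<longleftrightarrow> q \<le> (\<Sum>i=1..m. real (l i) * w i))"
    using assms(1) unfolding weighted_H_forall_iff by blast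
  let ?w = "w(Suc m := 0)"
  have "(\<forall>i\<in>{1..Suc m}. k i \<le> (\<Sum>j=1..i. l j)) \<longleftrightarrow> q \<le> (\<Sum>i=1..Suc m. real (l i) * ?w i)"
    if l: "\<forall>i\<in>{1..Suc m}. l i \<le> n i" for l
  proof -
    have "(\<forall>i\<in>{1..Suc m}. k i \<le> (\<Sum>j=1..i. l j)) \<longleftrightarrow> (\<forall>i\<in>{1..m}. k i \<le> (\<Sum>j=1..i. l j))"
      using assms(2,3) by (force simp: atLeastAtMostSuc_conv)
    moreover have "(\<Sum>i=1..Suc m. real (l i) * ?w i) = (\<Sum>i=1..m. real (l i) * w i)"
      by simp
    ultimately show ?thesis
      using wq[of l] l by simp
  qed
  then show ?thesis
    unfolding weighted_H_forall_iff using w q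
    by (intro exI[of _ ?w] exI[of _ q]) auto
qed

text \<open>A level that is needed in full gets a weight exceeding the total weight of all later ones.\<close>

lemma weighted_prepend_veto_level:
  assumes "weighted_majority_game m (\<lambda>i. n (i + 1)) (H_forall m (\<lambda>i. n (i + 1)) (\<lambda>i. k (i + 1) - k 1))"
    and "k 1 = n 1"
  shows "weighted_majority_game (Suc m) n (H_forall (Suc m) n k)"
proof -
  obtain w :: "nat \<Rightarrow> real" and q where w: "\<forall>i\<in>{1..m}. 0 \<le> w i" and q: "0 \<le> q" and
    wq: "\<And>l. \<forall>i\<in>{1..m}. l i \<le> n (i + 1) \<Longrightarrow>
      ((\<forall>i\<in>{1..m}. k (i + 1) - k 1 \<le> (\<Sum>j=1..i. l j)) \<longleftrightarrow> q \<le> (\<Sum>i=1..m. real (l i) * w i))"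
    using assms(1) unfolding weighted_H_forall_iff by blast
  define W where "W = (\<Sum>i=1..m. real (n (i + 1)) * w i) + 1"
  have W: "0 \<le> W"
    unfolding W_def using w by (intro add_nonneg_nonneg sum_nonneg) auto
  let ?w = "\<lambda>i. if i = 1 then W else w (i - 1)"
  have "(\<forall>i\<in>{1..Suc m}. k i \<le> (\<Sum>j=1..i. l j)) \<longleftrightarrow>
      W * n 1 + q \<le> (\<Sum>i=1..Suc m. real (l i) * ?w i)"
    if l: "\<forall>i\<in>{1..Suc m}. l i \<le> n i" for l
  proof -
    have split_first: "(\<Sum>i=1..Suc j. f i) = f 1 + (\<Sum>i=1..j. f (i + 1))"
      for f :: "nat \<Rightarrow> 'a :: comm_monoid_add" and j
      using sum.atLeast_Suc_atMost[of 1 "Suc j" f] sum.shift_bounds_cl_Suc_ivl[of f 1 j] by simp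
    have l1: "l 1 \<le> n 1" and ls: "\<forall>i\<in>{1..m}. l (i + 1) \<le> n (i + 1)"
      using l by auto
    have score: "(\<Sum>i=1..Suc m. real (l i) * ?w i) = real (l 1) * W + (\<Sum>i=1..m. real (l (i + 1)) * w i)"
      by (subst split_first) simp
    have wins: "(\<forall>i\<in>{1..Suc m}. k i \<le> (\<Sum>j=1..i. l j)) \<longleftrightarrow>
        k 1 \<le> l 1 \<and> (\<forall>i\<in>{1..m}. k (i + 1) \<le> l 1 + (\<Sum>j=1..i. l (j + 1)))"
    proof -
      have "{1..Suc m} = insert 1 (Suc ` {1..m})"
        by (auto simp: image_Suc_atLeastAtMost)
      then have "(\<forall>i\<in>{1..Suc m}. P i) \<longleftrightarrow> P 1 \<and> (\<forall>i\<in>{1..m}. P (Suc i))" for P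
        by (simp del: image_Suc_atLeastAtMost)
      then show ?thesis
        by (simp only: split_first) simp
    qed
    show ?thesis
    proof (cases "l 1 = n 1")
      \<comment> \<open>With level 1 complete, \<open>W * n 1\<close> cancels and the shifted game
        remains. Truncation in \<open>k (i + 1) - k 1\<close> is harmless: the difference is at most
        \<open>s\<close> iff \<open>k (i + 1) \<le> s + k 1\<close>.\<close>
      case True
      then show ?thesis
        unfolding wins score using wq[OF ls] assms(2)
        by (simp add: le_diff_conv add.commute mult.commute)
    next
      case False
      \<comment> \<open>A unit missing at level 1 costs \<open>W\<close>, which the later levels
        cannot make up; as \<open>0 \<le> q\<close>, the quota is missed.\<close>
      then have "real (l 1) + 1 \<le> real (n 1)"
        using l1 by linarith
      then have "(real (l 1) + 1) * W \<le> real (n 1) * W"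
        using W by (intro mult_right_mono)
      moreover have "(\<Sum>i=1..m. real (l (i + 1)) * w i) < W"
      proof -
        have "(\<Sum>i=1..m. real (l (i + 1)) * w i) \<le> (\<Sum>i=1..m. real (n (i + 1)) * w i)"
          using ls w by (intro sum_mono mult_right_mono) auto
        then show ?thesis by (simp add: W_def)
      qed
      ultimately have "\<not> W * n 1 + q \<le> (\<Sum>i=1..Suc m. real (l i) * ?w i)"
        unfolding score using q by (simp add: algebra_simps)
      moreover have "\<not> k 1 \<le> l 1"
        using False l1 assms(2) by simp
      ultimately show ?thesis
        unfolding wins by blast
    qed
  qed
  moreover have "\<forall>i\<in>{1..Suc m}. 0 \<le> ?w i"
  proof
    fix i assume "i \<in> {1..Suc m}"
    then show "0 \<le> ?w i" using w W by (cases i) auto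
  qed
  ultimately show ?thesis
    unfolding weighted_H_forall_iff using q W
    by (intro exI[of _ ?w] exI[of _ "W * n 1 + q"]) auto
qed

section \<open>Explicit weights for up to three levels\<close>

lemma weighted_case1: "weighted_majority_game 1 n (H_forall 1 n k)"
  unfolding weighted_H_forall_iff
  by (rule exI[of _ "\<lambda>_. 1"], rule exI[of _ "real (k 1)"]) simp

text \<open>The explicit weights below are natural numbers, so their verification can be moved from
  the reals to \<open>nat\<close>.\<close>

lemma weighted_two_levels:
  fixes w1 w2 q :: nat
  assumes "\<And>x y. x \<le> n 1 \<Longrightarrow> y \<le> n 2 \<Longrightarrow>
      (k 1 \<le> x \<and> k 2 \<le> x + y) \<longleftrightarrow> q \<le> x * w1 + y * w2"
  shows "weighted_majority_game 2 n (H_forall 2 n k)"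
proof -
  have "{1..2} = {1, 2 :: nat}" by auto
  then show ?thesis
    unfolding weighted_H_forall_iff using assms
    by (intro exI[of _ "\<lambda>i. if i = 1 then real w1 else real w2"] exI[of _ "real q"])
      (simp flip: of_nat_mult of_nat_add)
qed

text \<open>One unit of level 1 outweighs all of level 2, so scores compare lexicographically; the
  quota asks for \<open>k 1\<close> units of level 1 and at least one more unit of either
  level.\<close>

lemma weighted_case2:
  assumes "k 2 = k 1 + 1"
  shows "weighted_majority_game 2 n (H_forall 2 n k)"
proof (rule weighted_two_levels)
  fix x y assume y: "y \<le> n 2"
  let ?w = "n 2 + 1"
  show "(k 1 \<le> x \<and> k 2 \<le> x + y) \<longleftrightarrow> k 1 * ?w + 1 \<le> x * ?w + y * 1"
  proof (cases x "k 1" rule: linorder_cases)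
    case less
    then have "(x + 1) * ?w \<le> k 1 * ?w"
      by (intro mult_le_mono1) simp
    then show ?thesis using less y by simp
  next
    case equal
    then show ?thesis using assms by auto
  next
    case greater
    then have "(k 1 + 1) * ?w \<le> x * ?w"
      by (intro mult_le_mono1) simp
    then show ?thesis using greater assms by simp
  qed
qed

text \<open>With \<open>c = k 2 - k 1\<close>, the nearly equal weights \<open>c + 2\<close> and
  \<open>c + 1\<close> work. The quota is the least score that meets both thresholds, reached by
  \<open>k 1\<close> units of level 1 and \<open>c\<close> of level 2.\<close>

lemma weighted_case3:
  assumes "n 2 = k 2 - k 1 + 1" and "k 1 \<le> k 2"
  shows "weighted_majority_game 2 n (H_forall 2 n k)"
proof (rule weighted_two_levels)
  fix x y assume y: "y \<le> n 2"
  define c where "c = k 2 - k 1"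
  have k2: "k 2 = k 1 + c" and n2: "n 2 = c + 1"
    using assms by (auto simp: c_def)
  show "(k 1 \<le> x \<and> k 2 \<le> x + y) \<longleftrightarrow> k 1 * (c + 2) + c * (c + 1) \<le> x * (c + 2) + y * (c + 1)"
  proof (cases "k 1 \<le> x")
    case False
    \<comment> \<open>The heaviest violation of the first threshold, \<open>x = k 1 - 1\<close> and
      \<open>y = c + 1\<close>, misses the quota by exactly 1.\<close>
    then have "(x + 1) * (c + 2) \<le> k 1 * (c + 2)"
      by (intro mult_le_mono1) simp
    moreover have "y * (c + 1) \<le> (c + 1) * (c + 1)"
      using y n2 by (intro mult_le_mono1) simp
    ultimately show ?thesis using False by (simp add: algebra_simps)
  next
    case True
    then obtain t where t: "x = k 1 + t"
      using le_Suc_ex by blast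
    have "c \<le> t + y \<longleftrightarrow> c * (c + 1) \<le> t * (c + 2) + y * (c + 1)"
    proof
      assume "c \<le> t + y"
      then have "c * (c + 1) \<le> (t + y) * (c + 1)"
        by (rule mult_le_mono1)
      then show "c * (c + 1) \<le> t * (c + 2) + y * (c + 1)"
        by (simp add: algebra_simps)
    next
      assume *: "c * (c + 1) \<le> t * (c + 2) + y * (c + 1)"
      show "c \<le> t + y"
      proof (rule ccontr)
        assume "\<not> c \<le> t + y"
        \<comment> \<open>The score is \<open>(t + y) * (c + 1) + t\<close>, and
          \<open>t < c + 1\<close> keeps it below \<open>(t + y + 1) * (c + 1)\<close>.\<close>
        then have "t + y + 1 \<le> c" by simp
        moreover from this have "(t + y + 1) * (c + 1) \<le> c * (c + 1)"
          by (rule mult_le_mono1)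
        ultimately show False using * by (simp add: algebra_simps)
      qed
    qed
    then show ?thesis using t k2 by (simp add: algebra_simps)
  qed
qed

text \<open>Games with \<open>k 1 = n 1\<close> arise by prepending the full level to a weighted
  game with one level fewer.\<close>

lemma weighted_cases_1_to_4:
  assumes "wm_case1 m n k \<or> wm_case2 m n k \<or> wm_case3 m n k \<or> wm_case4 m n k"
    and "m = 2 \<Longrightarrow> k 1 \<le> k 2" and "m = 3 \<Longrightarrow> k 2 \<le> k 3"
  shows "weighted_majority_game m n (H_forall m n k)"
proof -
  consider "m = 1" | "m = 2" "k 2 = k 1 + 1" | "m = 2" "n 2 = k 2 - k 1 + 1"
    | "m = 2" "k 1 = n 1"
    | "m = 3" "k 1 = n 1" "wm_case2 2 (\<lambda>i. n (i + 1)) (\<lambda>i. k (i + 1) - k 1) \<or>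
         wm_case3 2 (\<lambda>i. n (i + 1)) (\<lambda>i. k (i + 1) - k 1)"
    using assms(1) unfolding wm_case1_def wm_case2_def[of m] wm_case3_def[of m] wm_case4_def
    by blast
  then show ?thesis
  proof cases
    case 1
    then show ?thesis using weighted_case1 by simp
  next
    case 2
    then show ?thesis using weighted_case2 by simp
  next
    case 3
    then show ?thesis using weighted_case3 assms(2) by simp
  next
    case 4
    then show ?thesis
      using weighted_prepend_veto_level[of 1 n k, OF weighted_case1] by (simp add: numeral_2_eq_2)
  next
    case 5
    let ?n = "\<lambda>i. n (i + 1)" and ?k = "\<lambda>i. k (i + 1) - k 1"
    have "?k 1 \<le> ?k 2"
      using assms(3) 5(1) by (simp add: numeral_2_eq_2 numeral_3_eq_3 diff_le_mono)
    then have "weighted_majority_game 2 ?n (H_forall 2 ?n ?k)"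
      using 5(3) weighted_case2[of ?k ?n] weighted_case3[of ?n ?k]
      unfolding wm_case2_def wm_case3_def by blast
    then show ?thesis
      using weighted_prepend_veto_level[of 2 n k] 5(1,2) by (simp add: numeral_3_eq_3 numeral_2_eq_2)
  qed
qed

section \<open>Which parameters admit weights\<close>

text \<open>
  Only the first \<open>M\<close> thresholds are required to increase strictly, so that \<open>M = m - 1\<close> covers the
  games with \<open>k m = k (m - 1)\<close>.
\<close>

lemma weighted_imp_cases_1_to_4:
  assumes weighted: "weighted_majority_game m n (H_forall m n k)"
    and M: "1 \<le> M" "M \<le> m"
    and k1: "0 < k 1" "k 1 \<le> n 1"
    and mono: "\<And>i. 1 < i \<Longrightarrow> i \<le> m \<Longrightarrow> k (i - 1) \<le> k i"
    and strict: "\<And>i. 1 < i \<Longrightarrow> i \<le> M \<Longrightarrow> k (i - 1) < k i"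
    and room: "\<And>i. 1 < i \<Longrightarrow> i \<le> m \<Longrightarrow> k i < k (i - 1) + n i"
  shows "wm_case1 M n k \<or> wm_case2 M n k \<or> wm_case3 M n k \<or> wm_case4 M n k"
proof -
  define d where "d i = (if i = 1 then k 1 else k i - k (i - 1))" for i
  have sum_d: "(\<Sum>j=1..i. d j) = k i" if "i \<in> {1..m}" for i
    unfolding d_def using sum_step_differences[of m k i] mono that by simp
  \<comment> \<open>From level 2 on, \<open>room\<close> leaves a spare unit beyond
    \<open>d i\<close>; only level 1 can be full.\<close>
  have d_less: "d i < n i" if "1 < i" "i \<le> m" for i
    using room[OF that] mono[OF that] that by (simp add: d_def)
  have d_le: "d i \<le> n i" if "i \<in> {1..m}" for i
    using that d_less[of i] k1 by (cases "i = 1") (auto simp: d_def)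
  \<comment> \<open>Positivity stops at \<open>M\<close>: if \<open>k m = k (m - 1)\<close>, the
    last difference is 0.\<close>
  have d_pos: "0 < d i" if "1 \<le> i" "i \<le> M" for i
    using strict[of i] k1 that by (cases "i = 1") (auto simp: d_def)
  \<comment> \<open>Trade against two units of level \<open>a + 1\<close>. It is blocked only if
    \<open>d\<close> has a single unit there or room for a single further one, which leads to cases
    2 and 3.\<close>
  have no_two: "d (a + 1) = 1 \<or> n (a + 1) = d (a + 1) + 1"
    if a: "1 \<le> a" "a + 1 \<le> M" "d a < n a" for a
  proof (rule ccontr)
    assume "\<not> (d (a + 1) = 1 \<or> n (a + 1) = d (a + 1) + 1)"
    moreover have "0 < d (a + 1)" "d (a + 1) < n (a + 1)"
      using d_pos[of "a + 1"] d_less[of "a + 1"] a M by auto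
    ultimately have "2 \<le> d (a + 1)" "d (a + 1) + 2 \<le> n (a + 1)"
      by auto
    then have "\<not> weighted_majority_game m n (H_forall m n k)"
      using a d_pos[of a] M d_le
      by (intro not_weighted_trade[of m d k n a "a + 1" "\<lambda>i. if i = a + 1 then 2 else 0", OF sum_d])
        auto
    then show False using weighted by contradiction
  qed
  \<comment> \<open>Trade against one unit each of levels \<open>a + 1\<close> and
    \<open>a + 2\<close>; up to level \<open>M\<close> both can always be added and removed.\<close>
  have no_three: "M < a + 2" if a: "1 \<le> a" "d a < n a" for a
  proof (rule ccontr)
    assume "\<not> M < a + 2"
    then have aM: "a + 2 \<le> M" by simp
    have "\<not> weighted_majority_game m n (H_forall m n k)"
    proof (rule not_weighted_trade[of m d k n a "a + 2" "\<lambda>i. if i = a + 1 \<or> i = a + 2 then 1 else 0",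
          OF sum_d d_le])
      show "2 \<le> (\<Sum>i=1..a + 2. if i = a + 1 \<or> i = a + 2 then 1 else 0 :: nat)"
        using a by simp
      fix i assume i: "i \<in> {1..m}"
      show "(if i = a + 1 \<or> i = a + 2 then 1 else 0) \<le> d i \<and>
          d i + (if i = a + 1 \<or> i = a + 2 then 1 else 0) \<le> n i"
        using d_pos[of i] d_less[of i] d_le[OF i] a aM M by auto
    qed (use a aM M d_pos[of a] in auto)
    then show False using weighted by contradiction
  qed
  show ?thesis
  proof (cases "k 1 = n 1")
    case False
    then have d1: "d 1 < n 1"
      using k1 by (simp add: d_def)
    then consider "M = 1" | "M = 2"
      using no_three[of 1] M by force
    then show ?thesis
    proof cases
      case 1
      then show ?thesis by (simp add: wm_case1_def)
    next
      case 2
      then have "d 2 = 1 \<or> n 2 = d 2 + 1"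
        using no_two[of 1] d1 by (simp add: numeral_2_eq_2)
      moreover have "k 1 < k 2"
        using strict[of 2] 2 by simp
      ultimately show ?thesis
        using 2 by (auto simp: wm_case2_def wm_case3_def d_def)
    qed
  next
    case True
    show ?thesis
    proof (cases "M \<le> 2")
      case small: True
      then show ?thesis
        using M True by (auto simp: wm_case1_def wm_case4_def)
    next
      case False
      \<comment> \<open>Level 1 is full and cannot gain a unit, so the trades start from level
        2.\<close>
      then have d2: "d 2 < n 2"
        using d_less[of 2] M by simp
      then have M3: "M = 3"
        using no_three[of 2] False by simp
      then have "d 3 = 1 \<or> n 3 = d 3 + 1"
        using no_two[of 2] d2 by (simp add: numeral_3_eq_3 numeral_2_eq_2)
      moreover have "k 1 < k 2" "k 2 < k 3"
        using strict[of 2] strict[of 3] M3 by auto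
      ultimately show ?thesis
        using M3 True
        by (auto simp: wm_case4_def wm_case2_def wm_case3_def d_def numeral_3_eq_3 numeral_2_eq_2)
    qed
  qed
qed

theorem theorem9:
  fixes m :: nat and n k :: "nat \<Rightarrow> nat"
  assumes "1 \<le> m"
    and "\<forall>i\<in>{1..m}. 0 < n i"
    and "\<forall>i\<in>{1..m}. 0 < k i"
    and "\<forall>i. 1 \<le> i \<and> i + 1 \<le> m - 1 \<longrightarrow> k i < k (i + 1)"
    and "1 < m \<longrightarrow> k (m - 1) \<le> k m"
    and "k 1 \<le> n 1"
    and "\<forall>i. 1 < i \<and> i \<le> m \<longrightarrow> k i < k (i - 1) + n i"
  shows "weighted_majority_game m n (H_forall m n k) \<longleftrightarrow>
    wm_case1 m n k \<or> wm_case2 m n k \<or> wm_case3 m n k \<or> wm_case4 m n k \<or> wm_case5 m n k"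
proof -
  have strict: "k (i - 1) < k i" if "1 < i" "i \<le> m - 1" for i
    using assms(4)[rule_format, of "i - 1"] that by simp
  have mono: "k (i - 1) \<le> k i" if "1 < i" "i \<le> m" for i
  proof (cases "i = m")
    case True
    then show ?thesis using assms(5) that by simp
  next
    case False
    then have "i \<le> m - 1" using that by simp
    then show ?thesis using strict[OF that(1)] by (simp add: less_imp_le)
  qed
  have "0 < k 1"
    using assms(1,3) by simp
  note converse = weighted_imp_cases_1_to_4[of m n k, OF _ _ _ this assms(6) mono]
  show ?thesis
  proof
    assume weighted: "weighted_majority_game m n (H_forall m n k)"
    show "wm_case1 m n k \<or> wm_case2 m n k \<or> wm_case3 m n k \<or> wm_case4 m n k \<or> wm_case5 m n k"
    \<comment> \<open>If the last two thresholds agree, \<open>M = m - 1\<close> yields case 5;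
      otherwise all thresholds increase strictly and \<open>M = m\<close> yields one of the
      others.\<close>
    proof (cases "1 < m \<and> k m = k (m - 1)")
      case True
      have "wm_case1 (m - 1) n k \<or> wm_case2 (m - 1) n k \<or> wm_case3 (m - 1) n k \<or> wm_case4 (m - 1) n k"
        using True assms(7) strict by (intro converse[OF weighted]) auto
      moreover from this have "m - 1 \<in> {1, 2, 3}"
        by (auto simp: wm_case1_def wm_case2_def wm_case3_def wm_case4_def)
      then have "m \<in> {2, 3, 4}" by auto
      ultimately have "wm_case5 m n k"
        unfolding wm_case5_def using True by blast
      then show ?thesis by blast
    next
      case False
      have "k (i - 1) < k i" if "1 < i" "i \<le> m" for i
        using mono[OF that] strict[of i] that False by (cases "i = m") auto
      then have "wm_case1 m n k \<or> wm_case2 m n k \<or> wm_case3 m n k \<or> wm_case4 m n k"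
        using assms(1,7) by (intro converse[OF weighted]) auto
      then show ?thesis by blast
    qed
  next
    assume "wm_case1 m n k \<or> wm_case2 m n k \<or> wm_case3 m n k \<or> wm_case4 m n k \<or> wm_case5 m n k"
    then consider
      "wm_case1 m n k \<or> wm_case2 m n k \<or> wm_case3 m n k \<or> wm_case4 m n k" | "wm_case5 m n k"
      by blast
    then show "weighted_majority_game m n (H_forall m n k)"
    proof cases
      case 1
      then show ?thesis
        using mono[of 2] mono[of 3] by (intro weighted_cases_1_to_4) auto
    next
      case 2
      then obtain p where p: "m = Suc p" "1 \<le> p" "k (Suc p) = k p"
        "wm_case1 p n k \<or> wm_case2 p n k \<or> wm_case3 p n k \<or> wm_case4 p n k"
        unfolding wm_case5_def by (cases m) auto
      have "weighted_majority_game p n (H_forall p n k)"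
        using p mono[of 2] mono[of 3] by (intro weighted_cases_1_to_4) auto
      then show ?thesis
        using weighted_append_trivial_level[of p n k] p by simp
    qed
  qed
qed

end
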